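(* Let $T\in(0,\infty)$, $d\in\mathbb{N}$, $u_0\in\mathbb{R}^d$, $\gamma\in(0,1]$, and let $f\colon[0,T]\times\mathbb{R}^d\to\mathbb{R}^d$ be continuous. Suppose there exist $L,K\in(0,\infty)$ such that $$|f(t,x_1)-f(t,x_2)|\le L|x_1-x_2|\quad\text{for all }t\in[0,T],\ x_1,x_2\in\mathbb{R}^d,$$ $$|f(t_1,x)-f(t_2,x)|\le K(1+|x|)|t_1-t_2|^\gamma\quad\text{for all }t_1,t_2\in[0,T],\ x\in\mathbb{R}^d.$$ Let $u$ be the exact solution to $\dot u(t)=f(t,u(t))$, $t\in[0,T]$, $u(0)=u_0$. Let $(h_m)_{m\in\mathbb{N}}\subset(0,1)$ be a given sequence of step sizes with $\sum_{m=1}^\infty h_m<\infty$. For each $m\in\mathbb{N}$, writing $t_j=jh_m$, let $(U^j_m)_{j\in\{0,1,\ldots,N_{h_m}\}}$ be determined by $U^0_m=u_0$ and $$U^j_m=U^{j-1}_m+h_mf(t_{j-1}+\tau_jh_m,U^{j-1}_m),\quad j\in\{1,\ldots,N_{h_m}\},$$ and let $(V^j_m)_{j\in\{0,1,\ldots,N_{h_m}\}}$ be determined by $V^0_m=u_0$ and $$V^j_{m,\tau}=V^{j-1}_m+h_m\tau_jf(t_{j-1},V^{j-1}_m),\qquad V^j_m=V^{j-1}_m+h_mf(t_{j-1}+\tau_jh_m,V^j_{m,\tau}),\quad j\in\{1,\ldots,N_{h_m}\}.$$ Then for every $\epsilon\in(0,\frac12)$ there exist a random variable $m_U\colon\Omega\to\mathbb{N}_0$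 and a measurable set $A_U\in\mathcal{F}$ with $\mathbb{P}(A_U)=1$ such that for every $\omega\in A_U$ and $m\ge m_U(\omega)$ $$\max_{n\in\{0,1,\ldots,N_{h_m}\}}|u(t_n)-U^n_m(\omega)|\le h_m^{\min(1,\frac12+\gamma)-\epsilon}.$$ In addition, for every $\epsilon\in(0,\frac12)$ there exist a random variable $m_V\colon\Omega\to\mathbb{N}_0$ and a measurable set $A_V\in\mathcal{F}$ with $\mathbb{P}(A_V)=1$ such that for every $\omega\in A_V$ and $m\ge m_V(\omega)$ $$\max_{n\in\{0,1,\ldots,N_{h_m}\}}|u(t_n)-V^n_m(\omega)|\le h_m^{\frac12+\gamma-\epsilon}.$$
   Context: $|\cdot|$ is the Euclidean norm on $\mathbb{R}^d$ and $\mathbb{N}_0=\mathbb{N}\cup\{0\}$. $(\tau_j)_{j\in\mathbb{N}}$ is an independent family of random variables, each uniformly distributed on $(0,1)$, on a probability space $(\Omega,\mathcal{F},\mathbb{P})$. For $h\in(0,1)$, $N_h\in\mathbb{N}_0$ is the integer determined by $N_hh\le T<(N_h+1)h$. Under the stated hypotheses on $f$ the initial value problem has a unique global solution $u\colon[0,T]\to\mathbb{R}^d$, which is continuously differentiable. *)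

theory Defs
  imports "HOL-Probability.Probability"
begin

definition nsteps :: "real \<Rightarrow> real \<Rightarrow> nat" where
  "nsteps T h = (THE N. real N * h \<le> T \<and> T < (real N + 1) * h)"

lemma nsteps_bounds:
  assumes "0 < h" and "0 \<le> T"
  shows "real (nsteps T h) * h \<le> T \<and> T < (real (nsteps T h) + 1) * h"
  unfolding nsteps_def
proof (rule theI')
  have iff: "real N * h \<le> T \<and> T < (real N + 1) * h \<longleftrightarrow> \<lfloor>T / h\<rfloor> = int N" for N
    using assms by (simp add: floor_eq_iff field_simps)
  have "0 \<le> \<lfloor>T / h\<rfloor>"
    using assms by simp
  then show "\<exists>!N. real N * h \<le> T \<and> T < (real N + 1) * h"
    unfolding iff by (metis int_nat_eq of_nat_eq_iff)
qed

text \<open>In both schemes \<open>s j\<close> is the realisation at a fixed outcome of the \<open>j\<close>-th random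
  variable (\<open>s 0\<close> is never used), so step \<open>Suc j\<close> starts at time \<open>real j * h\<close> and uses
  \<open>s (Suc j)\<close>.  The recursions are continued beyond the last step inside the time interval;
  those values play no role.\<close>

primrec randomized_euler ::
  "(real \<Rightarrow> 'a::real_vector \<Rightarrow> 'a) \<Rightarrow> 'a \<Rightarrow> real \<Rightarrow> (nat \<Rightarrow> real) \<Rightarrow> nat \<Rightarrow> 'a" where
  "randomized_euler f u0 h s 0 = u0"
| "randomized_euler f u0 h s (Suc j) =
     randomized_euler f u0 h s j
       + h *\<^sub>R f (real j * h + s (Suc j) * h) (randomized_euler f u0 h s j)"

primrec randomized_runge_kutta ::
  "(real \<Rightarrow> 'a::real_vector \<Rightarrow> 'a) \<Rightarrow> 'a \<Rightarrow> real \<Rightarrow> (nat \<Rightarrow> real) \<Rightarrow> nat \<Rightarrow> 'a" where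
  "randomized_runge_kutta f u0 h s 0 = u0"
| "randomized_runge_kutta f u0 h s (Suc j) =
     (let V = randomized_runge_kutta f u0 h s j;
          V\<^sub>\<tau> = V + (h * s (Suc j)) *\<^sub>R f (real j * h) V
      in V + h *\<^sub>R f (real j * h + s (Suc j) * h) V\<^sub>\<tau>)"

end

(* Put g(t) = f(t, u(t)). A solution on the compact interval is Lipschitz and g is gamma-Hoelder.
   The error of either scheme at step n is at most the quadrature error
   u(t_n) - u(0) - h * sum_{j<n} g(t_j + tau_{j+1} h), plus a consistency term of order h (Euler) or
   h^(1+gamma) (Runge-Kutta), plus a Lipschitz multiple of the earlier errors, which the discrete
   Gronwall inequality absorbs. The quadrature error is a sum of independent centred random vectors
   with components of size O(h^(1+gamma)), so Hoeffding's inequality bounds the probability that it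
   exceeds h^(1/2+gamma-delta) by exp(-c h^(-2 delta)). This decays faster than any power of h, so a
   plain union bound over the O(1/h) steps suffices in place of a maximal inequality for martingales,
   and summability of the step sizes allows Borel-Cantelli. The gap between delta and epsilon absorbs
   the constants. *)

theory Submission
  imports Defs "HOL-Real_Asymp.Real_Asymp"
begin

section \<open>Discrete Gronwall inequality\<close>

lemma discrete_gronwall:
  fixes e :: "nat \<Rightarrow> real"
  assumes "0 \<le> b" and "\<And>n. n \<le> N \<Longrightarrow> e n \<le> a + b * (\<Sum>j<n. e j)" and "n \<le> N"
  shows "e n \<le> a * (1 + b) ^ n"
proof -
  \<comment> \<open>The induction runs on the right-hand side of the hypothesis instead of on
    \<open>e n\<close>: passing to \<open>Suc n\<close> adds \<open>b * e n\<close>, which is at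
    most \<open>b\<close> times the old value, so each step costs a factor
    \<open>1 + b\<close>.\<close>
  have "a + b * (\<Sum>j<n. e j) \<le> a * (1 + b) ^ n" if "n \<le> N" for n
    using that
  proof (induction n)
    case (Suc n)
    then have IH: "a + b * (\<Sum>j<n. e j) \<le> a * (1 + b) ^ n"
      by simp
    have "e n \<le> a + b * (\<Sum>j<n. e j)"
      using assms(2) Suc.prems by simp
    then have "b * e n \<le> b * (a + b * (\<Sum>j<n. e j))"
      using assms(1) by (rule mult_left_mono)
    then have "a + b * (\<Sum>j<Suc n. e j) \<le> (1 + b) * (a + b * (\<Sum>j<n. e j))"
      by (simp add: algebra_simps)
    also have "\<dots> \<le> (1 + b) * (a * (1 + b) ^ n)"
      using IH assms(1) by (intro mult_left_mono) auto
    finally show ?case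
      by (simp add: algebra_simps)
  qed simp
  then show ?thesis
    using assms(2,3) order_trans by blast
qed

text \<open>Since \<open>(1 + c * h) ^ n\<close> is at most \<open>exp (c * (n * h))\<close> and
  \<open>n * h\<close> stays below \<open>T\<close>, the Gronwall factor becomes independent of the
  step size.\<close>

lemma discrete_gronwall_exp:
  fixes e :: "nat \<Rightarrow> real"
  assumes "0 \<le> a" and "0 \<le> c" and "0 \<le> h" and "real N * h \<le> T"
    and "\<And>n. n \<le> N \<Longrightarrow> e n \<le> a + c * h * (\<Sum>j<n. e j)" and "n \<le> N"
  shows "e n \<le> a * exp (c * T)"
proof -
  have "real n * h \<le> real N * h"
    using assms by (intro mult_right_mono) auto
  then have "real n * h \<le> T"
    using assms(4) by linarith
  then have le: "c * (real n * h) \<le> c * T"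
    using assms(2) by (rule mult_left_mono)
  have "e n \<le> a * (1 + c * h) ^ n"
    by (rule discrete_gronwall[where N = N]) (use assms in auto)
  also have "\<dots> \<le> a * exp (c * h) ^ n"
    using assms by (intro mult_left_mono power_mono exp_ge_add_one_self) auto
  also have "\<dots> = a * exp (c * (real n * h))"
    by (simp add: exp_of_nat_mult[symmetric] mult_ac)
  also have "\<dots> \<le> a * exp (c * T)"
    using le assms(1) by (intro mult_left_mono) auto
  finally show ?thesis .
qed

section \<open>Vanishing step sizes and absorption of constants\<close>

text \<open>With this limit, asymptotic facts about a real variable tending to 0 from the right
  transfer to the sequence of step sizes by composition.\<close>

lemma step_sizes_at_right_0:
  fixes h :: "nat \<Rightarrow> real"
  assumes "\<And>m. m \<ge> 1 \<Longrightarrow> h m \<in> {0<..<1}" and "summable (\<lambda>m. h (Suc m))"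
  shows "filterlim h (at_right 0) sequentially"
  unfolding filterlim_at
proof
  show "\<forall>\<^sub>F m in sequentially. h m \<in> {0<..} \<and> h m \<noteq> 0"
    using eventually_ge_at_top[of 1] by eventually_elim (use assms(1) in force)
  show "h \<longlonglongrightarrow> 0"
    using assms(2) summable_Suc_iff[of h] by (simp add: summable_LIMSEQ_zero)
qed

text \<open>For \<open>x\<close> in (0,1) both powers are at most
  \<open>x powr (r - \<epsilon> / 2)\<close>. The remaining factor
  \<open>x powr (\<epsilon> / 2)\<close> tends to 0 and swallows the constant
  \<open>(1 + K) * E\<close>.\<close>

lemma eventually_error_le_powr:
  fixes h :: "nat \<Rightarrow> real"
  assumes h: "filterlim h (at_right 0) sequentially"
    and "0 < \<epsilon>" and "r - \<epsilon> / 2 \<le> a" and "r - \<epsilon> / 2 \<le> b" and "0 \<le> K" and "0 \<le> E"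
  shows "\<forall>\<^sub>F m in sequentially. (h m powr a + K * h m powr b) * E \<le> h m powr (r - \<epsilon>)"
proof -
  have "((\<lambda>x::real. (1 + K) * E * x powr (\<epsilon> / 2)) \<longlongrightarrow> 0) (at_right 0)"
    using \<open>0 < \<epsilon>\<close> by real_asymp
  then have "\<forall>\<^sub>F x in at_right 0. (1 + K) * E * x powr (\<epsilon> / 2) < 1"
    by (rule order_tendstoD) simp
  moreover have "\<forall>\<^sub>F x in at_right 0. x \<in> {0<..<1::real}"
    by (rule eventually_at_right_real) simp
  ultimately have "\<forall>\<^sub>F x in at_right 0. (x powr a + K * x powr b) * E \<le> x powr (r - \<epsilon>)"
  proof eventually_elim
    case (elim x)
    have "(x powr a + K * x powr b) * E \<le> (x powr (r - \<epsilon> / 2) + K * x powr (r - \<epsilon> / 2)) * E"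
      using elim assms by (intro mult_right_mono add_mono mult_left_mono powr_mono') auto
    also have "\<dots> = x powr (r - \<epsilon>) * ((1 + K) * E * x powr (\<epsilon> / 2))"
      by (simp add: algebra_simps flip: powr_add)
    also have "\<dots> \<le> x powr (r - \<epsilon>)"
      using elim by (intro mult_left_le) auto
    finally show ?case .
  qed
  then show ?thesis
    using h by (rule eventually_compose_filterlim)
qed

section \<open>Deterministic error bounds for the two schemes\<close>

text \<open>The common frame for both schemes: \<open>w\<close> is the exact solution on the grid,
  \<open>\<Phi>\<close> the increment of the method, and \<open>G\<close> the exact right-hand side
  at the randomly chosen times. The consistency error \<open>p\<close> per step enters with weight
  \<open>h\<close>, so over \<open>n\<close> steps it contributes at most \<open>T * p\<close>;
  Gronwall handles the rest.\<close>

lemma one_step_method_error: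
  fixes U \<Phi> w G :: "nat \<Rightarrow> 'a::real_normed_vector"
  assumes U0: "U 0 = w 0" and U_Suc: "\<And>j. U (Suc j) = U j + h *\<^sub>R \<Phi> j"
    and stable: "\<And>j. j < N \<Longrightarrow> norm (G j - \<Phi> j) \<le> p + c * norm (w j - U j)"
    and quad: "\<And>n. n \<le> N \<Longrightarrow> norm (w n - w 0 - h *\<^sub>R (\<Sum>j<n. G j)) \<le> q"
    and "0 \<le> h" and "real N * h \<le> T" and "0 \<le> p" and "0 \<le> c" and "n \<le> N"
  shows "norm (w n - U n) \<le> (q + T * p) * exp (c * T)"
proof (rule discrete_gronwall_exp[where N = N and h = h and e = "\<lambda>n. norm (w n - U n)"])
  have "0 \<le> real N * h"
    using \<open>0 \<le> h\<close> by simp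
  then have "0 \<le> T"
    using \<open>real N * h \<le> T\<close> by linarith
  moreover have "0 \<le> q"
    using quad[of 0] by simp
  ultimately show "0 \<le> q + T * p"
    using \<open>0 \<le> p\<close> by simp
  fix n assume "n \<le> N"
  then have "real n * h \<le> T"
    using \<open>0 \<le> h\<close> \<open>real N * h \<le> T\<close> by (meson mult_right_mono of_nat_mono order_trans)
  have "U n = U 0 + h *\<^sub>R (\<Sum>j<n. \<Phi> j)"
    by (induction n) (simp_all add: U_Suc scaleR_add_right)
  \<comment> \<open>Adding and subtracting the sum of the \<open>G j\<close> separates the
    quadrature error from the part that stability controls.\<close>
  then have "w n - U n = (w n - w 0 - h *\<^sub>R (\<Sum>j<n. G j)) + h *\<^sub>R (\<Sum>j<n. G j - \<Phi> j)"
    by (simp add: U0 sum_subtractf algebra_simps)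
  then have "norm (w n - U n) \<le> norm (w n - w 0 - h *\<^sub>R (\<Sum>j<n. G j)) + h * norm (\<Sum>j<n. G j - \<Phi> j)"
    using \<open>0 \<le> h\<close> norm_triangle_ineq norm_scaleR by (metis abs_of_nonneg)
  also have "\<dots> \<le> q + h * (\<Sum>j<n. p + c * norm (w j - U j))"
    using \<open>n \<le> N\<close> \<open>0 \<le> h\<close> quad by (intro add_mono mult_left_mono sum_norm_le stable) auto
  also have "\<dots> = q + real n * h * p + c * h * (\<Sum>j<n. norm (w j - U j))"
    by (simp add: sum.distrib sum_distrib_left algebra_simps)
  also have "\<dots> \<le> q + T * p + c * h * (\<Sum>j<n. norm (w j - U j))"
    using \<open>real n * h \<le> T\<close> \<open>0 \<le> p\<close> by (simp add: mult_right_mono)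
  finally show "norm (w n - U n) \<le> q + T * p + c * h * (\<Sum>j<n. norm (w j - U j))" .
qed (use assms in auto)

lemma grid_points_in_interval:
  fixes h T s :: real
  assumes "0 < h" and "real N * h \<le> T" and "j < N" and "s \<in> {0..1}"
  shows "real j * h \<in> {0..T}" and "real j * h + s * h \<in> {0..T}"
proof -
  have "(real j + s) * h \<le> real N * h" "real j * h \<le> real N * h"
    using assms by (auto intro!: mult_right_mono)
  moreover have "0 \<le> real j * h" "0 \<le> s * h"
    using assms by auto
  ultimately show "real j * h \<in> {0..T}" "real j * h + s * h \<in> {0..T}"
    using assms(2) unfolding distrib_right atLeastAtMost_iff by linarith+
qed

text \<open>The scheme evaluates \<open>f\<close> at the random time but at the state of the left
  grid point. Between these two times the solution moves by at most \<open>B * h\<close>, so the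
  consistency error is \<open>L * B * h\<close>, of order one however smooth \<open>f\<close> is in
  time.\<close>

lemma randomized_euler_error:
  fixes u :: "real \<Rightarrow> 'a::real_normed_vector"
  assumes f_lipschitz: "\<And>t x y. t \<in> {0..T} \<Longrightarrow> norm (f t x - f t y) \<le> L * norm (x - y)"
    and u_lipschitz: "\<And>s t. s \<in> {0..T} \<Longrightarrow> t \<in> {0..T} \<Longrightarrow> norm (u s - u t) \<le> B * \<bar>s - t\<bar>"
    and "0 \<le> L" and "0 \<le> B" and "0 < h" and N: "real N * h \<le> T" and s: "\<And>j. s (Suc j) \<in> {0..1}"
    and quad: "\<And>n. n \<le> N \<Longrightarrow>
      norm (u (real n * h) - u 0
            - h *\<^sub>R (\<Sum>j<n. f (real j * h + s (Suc j) * h) (u (real j * h + s (Suc j) * h)))) \<le> q"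
    and "n \<le> N"
  shows "norm (u (real n * h) - randomized_euler f (u 0) h s n) \<le> (q + T * L * B * h) * exp (L * T)"
proof -
  have "norm (u (real n * h) - randomized_euler f (u 0) h s n) \<le> (q + T * (L * B * h)) * exp (L * T)"
  proof (rule one_step_method_error[where w = "\<lambda>n. u (real n * h)" and U = "randomized_euler f (u 0) h s"
        and \<Phi> = "\<lambda>j. f (real j * h + s (Suc j) * h) (randomized_euler f (u 0) h s j)"
        and G = "\<lambda>j. f (real j * h + s (Suc j) * h) (u (real j * h + s (Suc j) * h))"])
    fix j assume "j < N"
    let ?t = "real j * h" and ?\<theta> = "real j * h + s (Suc j) * h" and ?U = "randomized_euler f (u 0) h s j"
    note t = grid_points_in_interval[OF \<open>0 < h\<close> N \<open>j < N\<close> s[of j]]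
    have "norm (u ?\<theta> - u ?t) \<le> B * \<bar>s (Suc j) * h\<bar>"
      using u_lipschitz[OF t(2) t(1)] by simp
    also have "\<dots> \<le> B * h"
      using s[of j] \<open>0 < h\<close> \<open>0 \<le> B\<close> by (intro mult_left_mono) (auto simp: abs_mult)
    finally have "norm (u ?\<theta> - ?U) \<le> B * h + norm (u ?t - ?U)"
      using norm_triangle_ineq[of "u ?\<theta> - u ?t" "u ?t - ?U"] by simp
    then have "L * norm (u ?\<theta> - ?U) \<le> L * (B * h + norm (u ?t - ?U))"
      using \<open>0 \<le> L\<close> by (rule mult_left_mono)
    then show "norm (f ?\<theta> (u ?\<theta>) - f ?\<theta> ?U) \<le> L * B * h + L * norm (u ?t - ?U)"
      using f_lipschitz[OF t(2), of "u ?\<theta>" ?U] by (simp add: algebra_simps)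
  qed (use assms in auto)
  then show ?thesis
    by (simp add: mult_ac)
qed

text \<open>The inner stage is an explicit Euler step to the random time, so it misses the solution
  only by the Taylor remainder of order \<open>1 + \<gamma>\<close>. This removes the order-one
  barrier of the Euler scheme.\<close>

lemma randomized_runge_kutta_error:
  fixes u :: "real \<Rightarrow> 'a::real_normed_vector"
  assumes f_lipschitz: "\<And>t x y. t \<in> {0..T} \<Longrightarrow> norm (f t x - f t y) \<le> L * norm (x - y)"
    and u_taylor: "\<And>s t. s \<in> {0..T} \<Longrightarrow> t \<in> {0..T} \<Longrightarrow>
      norm (u s - u t - (s - t) *\<^sub>R f t (u t)) \<le> C * \<bar>s - t\<bar> powr (1 + \<gamma>)"
    and "0 \<le> L" and "0 \<le> C" and "0 \<le> \<gamma>" and "0 < h" and "h \<le> 1"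
    and N: "real N * h \<le> T" and s: "\<And>j. s (Suc j) \<in> {0..1}"
    and quad: "\<And>n. n \<le> N \<Longrightarrow>
      norm (u (real n * h) - u 0
            - h *\<^sub>R (\<Sum>j<n. f (real j * h + s (Suc j) * h) (u (real j * h + s (Suc j) * h)))) \<le> q"
    and "n \<le> N"
  shows "norm (u (real n * h) - randomized_runge_kutta f (u 0) h s n)
           \<le> (q + T * L * C * h powr (1 + \<gamma>)) * exp (L * (1 + L) * T)"
proof -
  let ?V = "randomized_runge_kutta f (u 0) h s"
  let ?W = "\<lambda>j. ?V j + (h * s (Suc j)) *\<^sub>R f (real j * h) (?V j)"
  have "norm (u (real n * h) - ?V n) \<le> (q + T * (L * C * h powr (1 + \<gamma>))) * exp (L * (1 + L) * T)"
  proof (rule one_step_method_error[where w = "\<lambda>n. u (real n * h)" and U = ?V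
        and \<Phi> = "\<lambda>j. f (real j * h + s (Suc j) * h) (?W j)"
        and G = "\<lambda>j. f (real j * h + s (Suc j) * h) (u (real j * h + s (Suc j) * h))"])
    fix j assume "j < N"
    let ?t = "real j * h" and ?\<theta> = "real j * h + s (Suc j) * h"
    note t = grid_points_in_interval[OF \<open>0 < h\<close> N \<open>j < N\<close> s[of j]]
    \<comment> \<open>The bound by 1 keeps \<open>h\<close> out of the stability constant
      \<open>L * (1 + L)\<close>; the bound by \<open>h\<close> serves the Taylor remainder.\<close>
    have sh: "0 \<le> h * s (Suc j)" "h * s (Suc j) \<le> 1" "h * s (Suc j) \<le> h"
      using s[of j] \<open>0 < h\<close> \<open>h \<le> 1\<close> by (auto simp: mult_le_one)
    have "norm (u ?\<theta> - u ?t - (h * s (Suc j)) *\<^sub>R f ?t (u ?t)) \<le> C * \<bar>h * s (Suc j)\<bar> powr (1 + \<gamma>)"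
      using u_taylor[OF t(2) t(1)] by (simp add: mult.commute)
    also have "\<dots> \<le> C * h powr (1 + \<gamma>)"
      using sh \<open>0 \<le> C\<close> \<open>0 \<le> \<gamma>\<close> by (intro mult_left_mono powr_mono2) auto
    finally have taylor: "norm (u ?\<theta> - u ?t - (h * s (Suc j)) *\<^sub>R f ?t (u ?t)) \<le> C * h powr (1 + \<gamma>)" .
    have "(h * s (Suc j)) * norm (f ?t (u ?t) - f ?t (?V j)) \<le> 1 * (L * norm (u ?t - ?V j))"
      using sh f_lipschitz[OF t(1)] by (intro mult_mono) auto
    \<comment> \<open>Taylor remainder at the exact state, plus the difference of two Euler stages
      started from the exact and the computed state.\<close>
    moreover have split: "u ?\<theta> - ?W j = (u ?\<theta> - u ?t - (h * s (Suc j)) *\<^sub>R f ?t (u ?t))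
        + ((u ?t - ?V j) + (h * s (Suc j)) *\<^sub>R (f ?t (u ?t) - f ?t (?V j)))"
      by (simp add: algebra_simps)
    have "norm (u ?\<theta> - ?W j) \<le> norm (u ?\<theta> - u ?t - (h * s (Suc j)) *\<^sub>R f ?t (u ?t))
        + (norm (u ?t - ?V j) + (h * s (Suc j)) * norm (f ?t (u ?t) - f ?t (?V j)))"
      unfolding split
      by (intro norm_triangle_mono order_refl) (simp only: norm_scaleR abs_of_nonneg[OF sh(1)] order_refl)
    ultimately have "norm (u ?\<theta> - ?W j) \<le> C * h powr (1 + \<gamma>) + (1 + L) * norm (u ?t - ?V j)"
      using taylor by (simp add: algebra_simps)
    then have "L * norm (u ?\<theta> - ?W j) \<le> L * (C * h powr (1 + \<gamma>) + (1 + L) * norm (u ?t - ?V j))"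
      using \<open>0 \<le> L\<close> by (rule mult_left_mono)
    then show "norm (f ?\<theta> (u ?\<theta>) - f ?\<theta> (?W j)) \<le> L * C * h powr (1 + \<gamma>) + L * (1 + L) * norm (u ?t - ?V j)"
      using f_lipschitz[OF t(2), of "u ?\<theta>" "?W j"] by (simp add: algebra_simps)
  qed (use assms in \<open>auto simp: Let_def\<close>)
  then show ?thesis
    by (simp add: mult_ac)
qed

section \<open>Regularity of the exact solution\<close>

text \<open>On a compact interval \<open>u\<close> is bounded, so the weight
  \<open>1 + norm x\<close> in the time regularity of \<open>f\<close> is harmless along the
  solution. Hoelder continuity of the derivative then yields the Taylor bound through the mean value
  inequality.\<close>

lemma solution_regularity:
  fixes f :: "real \<Rightarrow> 'a::real_normed_vector \<Rightarrow> 'a" and u :: "real \<Rightarrow> 'a"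
  assumes "0 < T" and "0 < \<gamma>" and "\<gamma> \<le> 1" and "0 < L" and "0 < K"
    and f_cont: "continuous_on ({0..T} \<times> UNIV) (\<lambda>(t, x). f t x)"
    and f_lipschitz: "\<And>t x y. t \<in> {0..T} \<Longrightarrow> norm (f t x - f t y) \<le> L * norm (x - y)"
    and f_holder: "\<And>s t x. s \<in> {0..T} \<Longrightarrow> t \<in> {0..T} \<Longrightarrow>
      norm (f s x - f t x) \<le> K * (1 + norm x) * \<bar>s - t\<bar> powr \<gamma>"
    and u: "\<And>t. t \<in> {0..T} \<Longrightarrow> (u has_vector_derivative f t (u t)) (at t within {0..T})"
  obtains B C where "0 < B" and "0 < C"
    and "continuous_on {0..T} (\<lambda>t. f t (u t))"
    and "\<And>s t. s \<in> {0..T} \<Longrightarrow> t \<in> {0..T} \<Longrightarrow> norm (u s - u t) \<le> B * \<bar>s - t\<bar>"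
    and "\<And>s t. s \<in> {0..T} \<Longrightarrow> t \<in> {0..T} \<Longrightarrow> norm (f s (u s) - f t (u t)) \<le> C * \<bar>s - t\<bar> powr \<gamma>"
    and "\<And>s t. s \<in> {0..T} \<Longrightarrow> t \<in> {0..T} \<Longrightarrow>
      norm (u s - u t - (s - t) *\<^sub>R f t (u t)) \<le> C * \<bar>s - t\<bar> powr (1 + \<gamma>)"
proof -
  let ?g = "\<lambda>t. f t (u t)"
  have u_cont: "continuous_on {0..T} u"
    unfolding continuous_on_eq_continuous_within using u has_vector_derivative_continuous by blast
  have "continuous_on {0..T} (\<lambda>t. (\<lambda>(t, x). f t x) (t, u t))"
    by (rule continuous_on_compose2[OF f_cont]) (auto intro!: continuous_intros u_cont)
  then have g_cont: "continuous_on {0..T} ?g"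
    by simp
  have "bounded (u ` {0..T})" "bounded (?g ` {0..T})"
    using u_cont g_cont by (auto intro!: compact_imp_bounded compact_continuous_image)
  then obtain b\<^sub>u b\<^sub>g where b: "0 < b\<^sub>u" "0 < b\<^sub>g" "\<And>t. t \<in> {0..T} \<Longrightarrow> norm (u t) \<le> b\<^sub>u"
      "\<And>t. t \<in> {0..T} \<Longrightarrow> norm (?g t) \<le> b\<^sub>g"
    unfolding bounded_pos by auto
  \<comment> \<open>The mean value inequality in linearized form gives \<open>2 * b\<^sub>g\<close>
    for the remainder, and the linear term adds another \<open>b\<^sub>g\<close>.\<close>
  define B where "B = 3 * b\<^sub>g"
  \<comment> \<open>The first summand covers the change of time at a fixed state. The second covers
    the change of state, where \<open>\<bar>s - t\<bar>\<close> is traded for its power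
    \<open>\<gamma>\<close> at the price of \<open>T powr (1 - \<gamma>)\<close>.\<close>
  define C where "C = K * (1 + b\<^sub>u) + L * B * T powr (1 - \<gamma>)"
  have segment: "closed_segment t s \<subseteq> {0..T}" if "s \<in> {0..T}" "t \<in> {0..T}" for s t
    using that by (auto simp: closed_segment_eq_real_ivl)
  have u_lip: "norm (u s - u t) \<le> B * \<bar>s - t\<bar>" if st: "s \<in> {0..T}" "t \<in> {0..T}" for s t
  proof -
    have "norm (u s - u t - (s - t) *\<^sub>R ?g t) \<le> norm (s - t) * (2 * b\<^sub>g)"
    proof (rule vector_differentiable_bound_linearization[where f' = ?g, OF u segment[OF st]])
      show "norm (?g x - ?g t) \<le> 2 * b\<^sub>g" if "x \<in> {0..T}" for x
        using norm_triangle_ineq4[of "?g x" "?g t"] b(4)[OF that] b(4)[OF st(2)] by simp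
    qed (use st in auto)
    moreover have "norm ((s - t) *\<^sub>R ?g t) \<le> norm (s - t) * b\<^sub>g"
      using b(4)[OF st(2)] by (auto intro: mult_left_mono)
    ultimately show ?thesis
      using norm_triangle_ineq[of "u s - u t - (s - t) *\<^sub>R ?g t" "(s - t) *\<^sub>R ?g t"]
      by (simp add: B_def algebra_simps)
  qed
  have "0 < B"
    using b by (simp add: B_def)
  then have "0 < C"
    using assms b by (simp add: C_def add_pos_nonneg)
  have g_holder: "norm (?g s - ?g t) \<le> C * \<bar>s - t\<bar> powr \<gamma>" if st: "s \<in> {0..T}" "t \<in> {0..T}" for s t
  proof -
    have "\<bar>s - t\<bar> = \<bar>s - t\<bar> powr (1 - \<gamma>) * \<bar>s - t\<bar> powr \<gamma>"
      by (simp flip: powr_add)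
    also have "\<dots> \<le> T powr (1 - \<gamma>) * \<bar>s - t\<bar> powr \<gamma>"
      using st \<open>\<gamma> \<le> 1\<close> by (intro mult_right_mono powr_mono2) auto
    finally have "L * B * \<bar>s - t\<bar> \<le> L * B * (T powr (1 - \<gamma>) * \<bar>s - t\<bar> powr \<gamma>)"
      using \<open>0 < L\<close> \<open>0 < B\<close> by (intro mult_left_mono) auto
    moreover have "L * norm (u s - u t) \<le> L * (B * \<bar>s - t\<bar>)"
      using u_lip[OF st] \<open>0 < L\<close> by (intro mult_left_mono) auto
    then have "norm (f t (u s) - f t (u t)) \<le> L * B * \<bar>s - t\<bar>"
      using f_lipschitz[OF st(2), of "u s" "u t"] by simp
    moreover have "K * (1 + norm (u s)) * \<bar>s - t\<bar> powr \<gamma> \<le> K * (1 + b\<^sub>u) * \<bar>s - t\<bar> powr \<gamma>"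
      using b(3)[OF st(1)] \<open>0 < K\<close> by (intro mult_right_mono mult_left_mono) auto
    then have "norm (f s (u s) - f t (u s)) \<le> K * (1 + b\<^sub>u) * \<bar>s - t\<bar> powr \<gamma>"
      using f_holder[OF st, of "u s"] by linarith
    ultimately show ?thesis
      using norm_triangle_ineq[of "f s (u s) - f t (u s)" "f t (u s) - f t (u t)"]
      by (simp add: C_def algebra_simps)
  qed
  have taylor: "norm (u s - u t - (s - t) *\<^sub>R ?g t) \<le> C * \<bar>s - t\<bar> powr (1 + \<gamma>)"
    if st: "s \<in> {0..T}" "t \<in> {0..T}" for s t
  proof -
    have "norm (u s - u t - (s - t) *\<^sub>R ?g t) \<le> norm (s - t) * (C * \<bar>s - t\<bar> powr \<gamma>)"
    \<comment> \<open>Restricting to the segment keeps every intermediate point within distance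
      \<open>\<bar>s - t\<bar>\<close> of \<open>t\<close>; on all of \<open>{0..T}\<close> the
      extra power \<open>\<gamma>\<close> would be lost.\<close>
    proof (rule vector_differentiable_bound_linearization[where f' = ?g and S = "closed_segment t s"])
      fix x assume x: "x \<in> closed_segment t s"
      then have x': "x \<in> {0..T}"
        using segment[OF st] by auto
      show "(u has_vector_derivative ?g x) (at x within closed_segment t s)"
        using u[OF x'] segment[OF st] by (rule has_vector_derivative_within_subset)
      have "\<bar>x - t\<bar> \<le> \<bar>s - t\<bar>"
        using x by (auto simp: closed_segment_eq_real_ivl split: if_splits)
      then have "C * \<bar>x - t\<bar> powr \<gamma> \<le> C * \<bar>s - t\<bar> powr \<gamma>"
        using \<open>0 < C\<close> \<open>0 < \<gamma>\<close> by (intro mult_left_mono powr_mono2) auto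
      then show "norm (?g x - ?g t) \<le> C * \<bar>s - t\<bar> powr \<gamma>"
        using g_holder[OF x' st(2)] by linarith
    qed auto
    then show ?thesis
      by (simp add: powr_add mult_ac)
  qed
  show ?thesis
    by (rule that[OF \<open>0 < B\<close> \<open>0 < C\<close> g_cont u_lip g_holder taylor])
qed

section \<open>Measurable choice of a random starting index\<close>

context prob_space
begin

lemma eventually_random_index:
  assumes [measurable]: "\<And>m. Measurable.pred M (P m)"
    and ev: "AE \<omega> in M. eventually (\<lambda>m. P m \<omega>) sequentially"
  obtains k A where "k \<in> measurable M (count_space (UNIV :: nat set))"
    and "A \<in> sets M" and "prob A = 1"
    and "\<And>\<omega> m. \<omega> \<in> A \<Longrightarrow> k \<omega> \<le> m \<Longrightarrow> P m \<omega>"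
proof
  \<comment> \<open>A least element of a countable family of measurable conditions is measurable.
    Where no index works \<open>LEAST\<close> is unspecified, but those outcomes lie outside
    \<open>?A\<close>.\<close>
  let ?k = "\<lambda>\<omega>. LEAST k. \<forall>m\<in>{k..}. P m \<omega>"
  let ?A = "{\<omega> \<in> space M. \<exists>k. \<forall>m\<in>{k..}. P m \<omega>}"
  show "?k \<in> measurable M (count_space UNIV)"
    by measurable
  show "?A \<in> sets M"
    by measurable
  moreover have "AE \<omega> in M. \<omega> \<in> ?A"
    using ev AE_space by eventually_elim (auto simp: eventually_sequentially)
  ultimately show "prob ?A = 1"
    using AE_in_set_eq_1 by blast
  fix \<omega> m assume "\<omega> \<in> ?A" "?k \<omega> \<le> m"
  then have "\<exists>k. \<forall>m\<in>{k..}. P m \<omega>"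
    by simp
  then have "\<forall>m\<in>{?k \<omega>..}. P m \<omega>"
    by (rule LeastI_ex)
  then show "P m \<omega>"
    using \<open>?k \<omega> \<le> m\<close> by (rule bspec[OF _ iffD2[OF atLeast_iff]])
qed

end

section \<open>Independent uniform random variables\<close>

locale iid_uniform = prob_space +
  fixes \<tau> :: "nat \<Rightarrow> 'a \<Rightarrow> real"
  assumes indep_\<tau>: "indep_vars (\<lambda>_. borel) \<tau> {1..}"
    and distr_\<tau>: "1 \<le> j \<Longrightarrow> distr M borel (\<tau> j) = uniform_measure lborel {0<..<1}"
begin

lemma measurable_\<tau>: "1 \<le> j \<Longrightarrow> \<tau> j \<in> borel_measurable M"
  using indep_\<tau> unfolding indep_vars_def by simp

text \<open>The form \<open>Suc j\<close> carries no side condition, so automatic measurability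
  proofs can use it inside the quadrature sums.\<close>

lemma measurable_\<tau>_Suc [measurable]: "\<tau> (Suc j) \<in> borel_measurable M"
  by (simp add: measurable_\<tau>)

lemma AE_\<tau>_in_unit_interval:
  assumes "1 \<le> j"
  shows "AE \<omega> in M. \<tau> j \<omega> \<in> {0<..<1}"
proof -
  have "AE x in distr M borel (\<tau> j). x \<in> {0<..<1}"
    unfolding distr_\<tau>[OF assms] by (rule AE_uniform_measureI) auto
  then show ?thesis
    using measurable_\<tau>[OF assms] by (subst (asm) AE_distr_iff) auto
qed

lemma AE_all_\<tau>_in_unit_interval: "AE \<omega> in M. \<forall>j. \<tau> (Suc j) \<omega> \<in> {0<..<1}"
  unfolding AE_all_countable using AE_\<tau>_in_unit_interval by simp

text \<open>The expectation is the integral of \<open>g\<close> over the unit interval, which the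
  fundamental theorem of calculus evaluates.\<close>

lemma expectation_comp_\<tau>:
  fixes F :: "real \<Rightarrow> real"
  assumes "1 \<le> j" and "continuous_on UNIV g"
    and deriv: "\<And>x. x \<in> {0..1} \<Longrightarrow> (F has_vector_derivative g x) (at x within {0..1})"
  shows "expectation (\<lambda>\<omega>. g (\<tau> j \<omega>)) = F 1 - F 0"
proof -
  have [measurable]: "g \<in> borel_measurable borel"
    using assms(2) by (rule borel_measurable_continuous_onI)
  have uniform: "uniform_measure lborel {0<..<1} = density lborel (\<lambda>x. ennreal (indicator {0<..<1::real} x))"
    by (simp add: uniform_measure_def ennreal_indicator divide_ennreal_def)
  have "expectation (\<lambda>\<omega>. g (\<tau> j \<omega>)) = integral\<^sup>L (uniform_measure lborel {0<..<1}) g"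
    using measurable_\<tau>[OF assms(1)] by (simp add: integral_distr flip: distr_\<tau>[OF assms(1)])
  also have "\<dots> = (\<integral>x. indicator {0<..<1} x *\<^sub>R g x \<partial>lborel)"
    unfolding uniform by (rule integral_density) auto
  \<comment> \<open>The fundamental theorem is applied on the closed interval; the two endpoints
    form a null set.\<close>
  also have "\<dots> = (\<integral>x. indicator {0..1} x *\<^sub>R g x \<partial>lborel)"
  proof (rule integral_cong_AE)
    show "AE x in lborel. indicator {0<..<1} x *\<^sub>R g x = indicator {0..1} x *\<^sub>R g x"
      using AE_lborel_singleton[of 0] AE_lborel_singleton[of 1]
      by eventually_elim (auto simp: indicator_def)
  qed auto
  also have "\<dots> = F 1 - F 0"
    using assms(2) deriv by (intro integral_FTC_Icc) (auto intro: continuous_on_subset)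
  finally show ?thesis .
qed

section \<open>Concentration of the randomized quadrature\<close>

text \<open>Each summand is an unbiased estimate of the increment of \<open>u\<close> over its
  subinterval, and Hoelder continuity confines it to an interval of width
  \<open>2 * C * h powr (1 + \<gamma>)\<close>. Hoeffding's inequality then applies to the
  sum.\<close>

lemma quadrature_deviation:
  fixes u g :: "real \<Rightarrow> real"
  assumes g: "continuous_on UNIV g"
    and u: "\<And>t. t \<in> {0..T} \<Longrightarrow> (u has_vector_derivative g t) (at t within {0..T})"
    and holder: "\<And>s t. s \<in> {0..T} \<Longrightarrow> t \<in> {0..T} \<Longrightarrow> \<bar>g s - g t\<bar> \<le> C * \<bar>s - t\<bar> powr \<gamma>"
    and "0 < C" and "0 < \<gamma>" and "0 < h" and "0 < T" and "real n * h \<le> T" and "0 < \<epsilon>"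
  shows "prob {\<omega> \<in> space M. \<epsilon> \<le> \<bar>u (real n * h) - u 0 - h * (\<Sum>j<n. g (real j * h + \<tau> (Suc j) \<omega> * h))\<bar>}
           \<le> 2 * exp (- (\<epsilon>\<^sup>2 / (2 * C\<^sup>2 * T * h powr (1 + 2 * \<gamma>))))"
proof (cases "n = 0")
  \<comment> \<open>With no summands the Hoeffding denominator would vanish; the error is then
    exactly 0 and the event is empty.\<close>
  case True
  with \<open>0 < \<epsilon>\<close> show ?thesis
    by simp
next
  case False
  \<comment> \<open>Summands are numbered from 1 like the \<open>\<tau> j\<close>, so summand
    \<open>j\<close> belongs to the subinterval starting at \<open>(real j - 1) * h\<close>. The
    limits \<open>a j\<close> and \<open>b j\<close> are centred at the value at that left
    endpoint.\<close>
  define X where "X j \<omega> = h * g ((real j - 1) * h + \<tau> j \<omega> * h)" for j \<omega>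
  define a where "a j = h * (g ((real j - 1) * h) - C * h powr \<gamma>)" for j :: nat
  define b where "b j = h * (g ((real j - 1) * h) + C * h powr \<gamma>)" for j :: nat
  have [measurable]: "g \<in> borel_measurable borel"
    using g by (rule borel_measurable_continuous_onI)
  have in_T: "(real j - 1) * h \<in> {0..T}" "(real j - 1) * h + s * h \<in> {0..T}"
    if "j \<in> {1..n}" "s \<in> {0..1}" for j s
  proof -
    have "j - 1 < n" "real (j - 1) = real j - 1"
      using that by auto
    then show "(real j - 1) * h \<in> {0..T}" "(real j - 1) * h + s * h \<in> {0..T}"
      using grid_points_in_interval[OF \<open>0 < h\<close> \<open>real n * h \<le> T\<close>, of "j - 1" s] that by simp_all
  qed
  have X_bounds: "AE \<omega> in M. X j \<omega> \<in> {a j..b j}" if j: "j \<in> {1..n}" for j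
  proof -
    have "1 \<le> j"
      using j by simp
    from AE_\<tau>_in_unit_interval[OF this] show ?thesis
    proof eventually_elim
      fix \<omega> assume \<tau>: "\<tau> j \<omega> \<in> {0<..<1}"
      have "\<bar>g ((real j - 1) * h + \<tau> j \<omega> * h) - g ((real j - 1) * h)\<bar> \<le> C * \<bar>\<tau> j \<omega> * h\<bar> powr \<gamma>"
        using holder[OF in_T(2)[OF j] in_T(1)[OF j, of 0], of "\<tau> j \<omega>"] \<tau> by auto
      also have "\<dots> \<le> C * h powr \<gamma>"
        using \<tau> assms(4-6) by (intro mult_left_mono powr_mono2) (auto simp: abs_mult)
      finally show "X j \<omega> \<in> {a j..b j}"
        using \<open>0 < h\<close> by (auto simp: X_def a_def b_def intro!: mult_left_mono)
    qed
  qed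
  have "indep_vars (\<lambda>_. borel) X {1..n}"
    unfolding X_def by (rule indep_vars_compose2[OF indep_vars_subset[OF indep_\<tau>]]) auto
  then interpret Hoeffding_ineq M "{1..n}" X a b "\<Sum>j=1..n. expectation (X j)"
    using X_bounds by unfold_locales simp_all
  have exp_X: "expectation (X j) = u (real j * h) - u ((real j - 1) * h)" if j: "j \<in> {1..n}" for j
  proof -
    \<comment> \<open>Rescaling the subinterval to the unit interval produces the factor
      \<open>h\<close> in the derivative, so \<open>?F\<close> is the antiderivative that identifies
      the mean as an increment of \<open>u\<close>.\<close>
    let ?F = "\<lambda>s. u ((real j - 1) * h + s * h)"
    have "expectation (\<lambda>\<omega>. h * g ((real j - 1) * h + \<tau> j \<omega> * h)) = ?F 1 - ?F 0"
    proof (rule expectation_comp_\<tau>[where g = "\<lambda>s. h * g ((real j - 1) * h + s * h)"])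
      show "continuous_on UNIV (\<lambda>s. h * g ((real j - 1) * h + s * h))"
        by (intro continuous_intros continuous_on_compose2[OF g]) auto
      fix s :: real assume s: "s \<in> {0..1}"
      have "((u \<circ> (\<lambda>s. (real j - 1) * h + s * h)) has_vector_derivative h *\<^sub>R g ((real j - 1) * h + s * h))
              (at s within {0..1})"
      proof (rule vector_diff_chain_within)
        show "((\<lambda>s. (real j - 1) * h + s * h) has_vector_derivative h) (at s within {0..1})"
          by (auto intro!: derivative_eq_intros)
        show "(u has_vector_derivative g ((real j - 1) * h + s * h))
                (at ((real j - 1) * h + s * h) within (\<lambda>s. (real j - 1) * h + s * h) ` {0..1})"
          using in_T(2)[OF j] by (intro has_vector_derivative_within_subset[OF u[OF in_T(2)[OF j s]]] image_subsetI)
      qed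
      then show "(?F has_vector_derivative h * g ((real j - 1) * h + s * h)) (at s within {0..1})"
        by (simp add: o_def)
    qed (use j in auto)
    then show ?thesis
      by (simp add: X_def[abs_def] algebra_simps)
  qed
  have "(\<Sum>j=1..n. expectation (X j)) = (\<Sum>j=1..n. u (real j * h) - u ((real j - 1) * h))"
    by (intro sum.cong refl exp_X) auto
  also have "\<dots> = (\<Sum>j<n. u (real (Suc j) * h) - u (real j * h))"
    unfolding One_nat_def sum.atLeast1_atMost_eq by simp
  also have "\<dots> = u (real n * h) - u 0"
    by (subst sum_lessThan_telescope) simp
  finally have mean: "(\<Sum>j=1..n. expectation (X j)) = u (real n * h) - u 0" .
  have total: "(\<Sum>j=1..n. X j \<omega>) = h * (\<Sum>j<n. g (real j * h + \<tau> (Suc j) \<omega> * h))" for \<omega>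
    unfolding One_nat_def sum.atLeast1_atMost_eq by (simp add: X_def sum_distrib_left)
  have deviation: "\<bar>(\<Sum>j=1..n. X j \<omega>) - (\<Sum>j=1..n. expectation (X j))\<bar>
      = \<bar>u (real n * h) - u 0 - h * (\<Sum>j<n. g (real j * h + \<tau> (Suc j) \<omega> * h))\<bar>" for \<omega>
    unfolding mean total by (rule abs_minus_commute)
  have width: "b j - a j = 2 * C * h powr (1 + \<gamma>)" for j
    using \<open>0 < h\<close> by (simp add: a_def b_def powr_add algebra_simps)
  have "prob {\<omega> \<in> space M. \<epsilon> \<le> \<bar>(\<Sum>j=1..n. X j \<omega>) - (\<Sum>j=1..n. expectation (X j))\<bar>}
          \<le> 2 * exp (- 2 * \<epsilon>\<^sup>2 / (\<Sum>j=1..n. (b j - a j)\<^sup>2))"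
    by (rule Hoeffding_ineq_abs_ge) (use assms False in \<open>auto simp: width\<close>)
  moreover have "2 * exp (- 2 * \<epsilon>\<^sup>2 / (\<Sum>j=1..n. (b j - a j)\<^sup>2))
      \<le> 2 * exp (- (\<epsilon>\<^sup>2 / (2 * C\<^sup>2 * T * h powr (1 + 2 * \<gamma>))))"
  proof -
    \<comment> \<open>One factor \<open>h\<close> is split off to pair with the \<open>n\<close>
      summands, as \<open>real n * h\<close> is at most \<open>T\<close>. The remaining power
      \<open>1 + 2 * \<gamma>\<close> has the square root \<open>1/2 + \<gamma>\<close>, the rate of
      the quadrature.\<close>
    have "(h powr (1 + \<gamma>))\<^sup>2 = h * h powr (1 + 2 * \<gamma>)"
      using \<open>0 < h\<close> powr_add[of h \<gamma> \<gamma>]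
      by (simp add: powr_add power2_eq_square flip: powr_mult_base)
    then have "(\<Sum>j=1..n. (b j - a j)\<^sup>2) = 4 * C\<^sup>2 * h powr (1 + 2 * \<gamma>) * (real n * h)"
      by (simp add: width power_mult_distrib)
    also have "\<dots> \<le> 4 * C\<^sup>2 * h powr (1 + 2 * \<gamma>) * T"
      using \<open>real n * h \<le> T\<close> by (intro mult_left_mono) auto
    finally have "2 * \<epsilon>\<^sup>2 / (4 * C\<^sup>2 * h powr (1 + 2 * \<gamma>) * T) \<le> 2 * \<epsilon>\<^sup>2 / (\<Sum>j=1..n. (b j - a j)\<^sup>2)"
      using False assms by (intro divide_left_mono) (auto simp: width)
    then show ?thesis
      by (simp add: mult_ac)
  qed
  ultimately show ?thesis
    unfolding deviation by (rule order_trans)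
qed

text \<open>The scalar bound is applied to each coordinate and each grid index; a union bound and
  Borel-Cantelli finish.\<close>

lemma quadrature_AE_eventually:
  fixes u g :: "real \<Rightarrow> 'b::euclidean_space"
  assumes g: "continuous_on UNIV g"
    and u: "\<And>t. t \<in> {0..T} \<Longrightarrow> (u has_vector_derivative g t) (at t within {0..T})"
    and holder: "\<And>s t. s \<in> {0..T} \<Longrightarrow> t \<in> {0..T} \<Longrightarrow> norm (g s - g t) \<le> C * \<bar>s - t\<bar> powr \<gamma>"
    and "0 < C" and "0 < \<gamma>" and "0 < T" and "0 < \<delta>"
    and h: "\<And>m. m \<ge> 1 \<Longrightarrow> h m \<in> {0<..<1}" and sum_h: "summable (\<lambda>m. h (Suc m))"
  shows "AE \<omega> in M. \<forall>\<^sub>F m in sequentially. \<forall>n\<le>nsteps T (h m).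
           norm (u (real n * h m) - u 0 - h m *\<^sub>R (\<Sum>j<n. g (real j * h m + \<tau> (Suc j) \<omega> * h m)))
             \<le> h m powr (1/2 + \<gamma> - \<delta>)"
proof -
  define D where "D m n \<omega> = u (real n * h m) - u 0 - h m *\<^sub>R (\<Sum>j<n. g (real j * h m + \<tau> (Suc j) \<omega> * h m))"
    for m n \<omega>
  define A where "A m = {\<omega> \<in> space M. \<exists>n\<in>{..nsteps T (h m)}. h m powr (1/2 + \<gamma> - \<delta>) < norm (D m n \<omega>)}" for m
  define d where "d = real DIM('b)"
  \<comment> \<open>The constant left in the Hoeffding exponent after inserting the threshold
    \<open>h m powr (1/2 + \<gamma> - \<delta>) / d\<close>; the power
    \<open>1 + 2 * \<gamma>\<close> cancels and only \<open>h m powr (-2 * \<delta>)\<close>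
    remains.\<close>
  define c where "c = 1 / (2 * C\<^sup>2 * T * d\<^sup>2)"
  have "0 < d"
    by (simp add: d_def)
  then have "0 < c"
    using assms by (simp add: c_def)
  have [measurable]: "g \<in> borel_measurable borel"
    using g by (rule borel_measurable_continuous_onI)
  have D_meas [measurable]: "D m n \<in> borel_measurable M" for m n
    unfolding D_def by measurable
  have A_meas [measurable]: "A m \<in> sets M" for m
    unfolding A_def by measurable
  have component: "prob {\<omega> \<in> space M. h m powr (1/2 + \<gamma> - \<delta>) / d \<le> \<bar>D m n \<omega> \<bullet> i\<bar>} \<le> 2 * exp (- (c * h m powr (-2 * \<delta>)))"
    if m: "m \<ge> 1" and n: "n \<le> nsteps T (h m)" and i: "i \<in> Basis" for m n i
  proof -
    have hm: "0 < h m"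
      using h[OF m] by simp
    have "real n * h m \<le> real (nsteps T (h m)) * h m"
      using n hm by (intro mult_right_mono) auto
    then have nh: "real n * h m \<le> T"
      using nsteps_bounds[OF hm, of T] \<open>0 < T\<close> by linarith
    have "prob {\<omega> \<in> space M. h m powr (1/2 + \<gamma> - \<delta>) / d
              \<le> \<bar>u (real n * h m) \<bullet> i - u 0 \<bullet> i - h m * (\<Sum>j<n. g (real j * h m + \<tau> (Suc j) \<omega> * h m) \<bullet> i)\<bar>}
          \<le> 2 * exp (- ((h m powr (1/2 + \<gamma> - \<delta>) / d)\<^sup>2 / (2 * C\<^sup>2 * T * h m powr (1 + 2 * \<gamma>))))"
    proof (rule quadrature_deviation)
      show "continuous_on UNIV (\<lambda>t. g t \<bullet> i)"
        using g by (intro continuous_intros)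
      show "((\<lambda>t. u t \<bullet> i) has_vector_derivative g t \<bullet> i) (at t within {0..T})" if "t \<in> {0..T}" for t
        using u[OF that] by (rule bounded_linear.has_vector_derivative[OF bounded_linear_inner_left])
      show "\<bar>g s \<bullet> i - g t \<bullet> i\<bar> \<le> C * \<bar>s - t\<bar> powr \<gamma>" if "s \<in> {0..T}" "t \<in> {0..T}" for s t
        using holder[OF that] Basis_le_norm[OF i, of "g s - g t"] by (simp add: inner_diff_left)
    qed (use assms hm nh \<open>0 < d\<close> in auto)
    also have "(h m powr (1/2 + \<gamma> - \<delta>) / d)\<^sup>2 / (2 * C\<^sup>2 * T * h m powr (1 + 2 * \<gamma>)) = c * h m powr (-2 * \<delta>)"
    proof -
      have "(h m powr (1/2 + \<gamma> - \<delta>))\<^sup>2 = h m powr (1 + 2 * \<gamma>) * h m powr (-2 * \<delta>)"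
        by (simp add: power2_eq_square algebra_simps flip: powr_add)
      then show ?thesis
        using hm by (simp add: c_def power_divide)
    qed
    finally show ?thesis
      by (simp add: D_def inner_diff_left inner_sum_left)
  qed
  have prob_A: "prob (A m) \<le> (T / h m + 1) * (d * (2 * exp (- (c * h m powr (-2 * \<delta>)))))" if m: "m \<ge> 1" for m
  proof -
    let ?N = "nsteps T (h m)"
    let ?B = "\<lambda>n i. {\<omega> \<in> space M. h m powr (1/2 + \<gamma> - \<delta>) / d \<le> \<bar>D m n \<omega> \<bullet> i\<bar>}"
    have hm: "0 < h m"
      using h[OF m] by simp
    have "A m \<subseteq> (\<Union>n\<in>{..?N}. \<Union>i\<in>Basis. ?B n i)"
    proof
      fix \<omega> assume "\<omega> \<in> A m"
      then obtain n where \<omega>: "\<omega> \<in> space M" and n: "n \<le> ?N" and lt: "h m powr (1/2 + \<gamma> - \<delta>) < norm (D m n \<omega>)"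
        by (auto simp: A_def)
      \<comment> \<open>The norm is at most the sum of the \<open>d\<close> absolute coordinates, so
        one of them carries at least the share \<open>1 / d\<close> of the threshold.\<close>
      have "\<exists>i\<in>Basis. h m powr (1/2 + \<gamma> - \<delta>) / d \<le> \<bar>D m n \<omega> \<bullet> i\<bar>"
      proof (rule ccontr)
        assume "\<not> ?thesis"
        then have "(\<Sum>i\<in>Basis. \<bar>D m n \<omega> \<bullet> i\<bar>) \<le> d * (h m powr (1/2 + \<gamma> - \<delta>) / d)"
          unfolding d_def by (intro sum_bounded_above) auto
        with lt norm_le_l1[of "D m n \<omega>"] \<open>0 < d\<close> show False
          by simp
      qed
      with \<omega> n show "\<omega> \<in> (\<Union>n\<in>{..?N}. \<Union>i\<in>Basis. ?B n i)"
        by blast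
    qed
    moreover have "(\<Union>n\<in>{..?N}. \<Union>i\<in>Basis. ?B n i) \<in> events"
      by (intro sets.finite_UN finite_atMost finite_Basis) measurable
    ultimately have "prob (A m) \<le> prob (\<Union>n\<in>{..?N}. \<Union>i\<in>Basis. ?B n i)"
      by (rule finite_measure_mono)
    also have "\<dots> \<le> (\<Sum>n\<le>?N. prob (\<Union>i\<in>Basis. ?B n i))"
      by (intro finite_measure_subadditive_finite) auto
    also have "\<dots> \<le> (\<Sum>n\<le>?N. \<Sum>i\<in>Basis. prob (?B n i))"
      by (intro sum_mono finite_measure_subadditive_finite) auto
    also have "\<dots> \<le> (\<Sum>n\<le>?N. \<Sum>i\<in>(Basis :: 'b set). 2 * exp (- (c * h m powr (-2 * \<delta>))))"
      using m by (intro sum_mono component) auto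
    also have "\<dots> = (real ?N + 1) * (d * (2 * exp (- (c * h m powr (-2 * \<delta>)))))"
      by (simp add: d_def add.commute)
    also have "\<dots> \<le> (T / h m + 1) * (d * (2 * exp (- (c * h m powr (-2 * \<delta>)))))"
      using nsteps_bounds[OF hm, of T] hm \<open>0 < T\<close> \<open>0 < d\<close>
      by (intro mult_right_mono) (auto simp: field_simps)
    finally show ?thesis .
  qed
  have "AE \<omega> in M. \<forall>\<^sub>F m in sequentially. \<omega> \<in> space M - A m"
  proof (rule borel_cantelli_AE1)
    \<comment> \<open>Dividing by \<open>x\<close> compares the union bound with the step size
      itself: eventually \<open>prob (A m)\<close> is at most \<open>h m\<close>, which is
      summable.\<close>
    have "((\<lambda>x::real. (T / x + 1) * (d * (2 * exp (- (c * x powr (-2 * \<delta>))))) / x) \<longlongrightarrow> 0) (at_right 0)"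
      using \<open>0 < c\<close> \<open>0 < \<delta>\<close> \<open>0 < T\<close> \<open>0 < d\<close> by real_asymp
    then have "\<forall>\<^sub>F x in at_right 0. (T / x + 1) * (d * (2 * exp (- (c * x powr (-2 * \<delta>))))) / x < 1"
      by (rule order_tendstoD) simp
    moreover have "filterlim h (at_right 0) sequentially"
      using h sum_h by (rule step_sizes_at_right_0)
    ultimately have "\<forall>\<^sub>F m in sequentially. (T / h m + 1) * (d * (2 * exp (- (c * h m powr (-2 * \<delta>))))) / h m < 1"
      by (rule eventually_compose_filterlim)
    then have "\<forall>\<^sub>F m in sequentially. norm (prob (A m)) \<le> h m"
      using eventually_ge_at_top[of 1]
    proof eventually_elim
      case (elim m)
      then show ?case
        using prob_A[of m] h[of m] by (simp add: divide_less_eq)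
    qed
    moreover have "summable h"
      using sum_h by (simp add: summable_Suc_iff)
    ultimately show "summable (\<lambda>m. prob (A m))"
      by (rule summable_comparison_test_ev)
  qed (auto simp: emeasure_eq_measure)
  then show ?thesis
    by eventually_elim (auto simp: A_def D_def not_less elim!: eventually_mono)
qed

section \<open>Pathwise rates for an abstract scheme\<close>

text \<open>The scheme \<open>S\<close> enters only through its deterministic error bound, so both
  claims become instances. Half of \<open>\<epsilon>\<close> is spent on the quadrature deviation
  and half on absorbing the constants.\<close>

lemma pathwise_convergence_rate:
  fixes u g :: "real \<Rightarrow> 'b::euclidean_space" and S :: "real \<Rightarrow> (nat \<Rightarrow> real) \<Rightarrow> nat \<Rightarrow> 'b"
  assumes g: "continuous_on {0..T} g"
    and u: "\<And>t. t \<in> {0..T} \<Longrightarrow> (u has_vector_derivative g t) (at t within {0..T})"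
    and holder: "\<And>s t. s \<in> {0..T} \<Longrightarrow> t \<in> {0..T} \<Longrightarrow> norm (g s - g t) \<le> C * \<bar>s - t\<bar> powr \<gamma>"
    and "0 < C" and "0 < \<gamma>" and "0 < T"
    and h: "\<And>m. m \<ge> 1 \<Longrightarrow> h m \<in> {0<..<1}" and sum_h: "summable (\<lambda>m. h (Suc m))"
    and error: "\<And>h s N q n. h \<in> {0<..<1} \<Longrightarrow> real N * h \<le> T \<Longrightarrow> (\<And>j. s (Suc j) \<in> {0..1}) \<Longrightarrow>
      (\<And>n. n \<le> N \<Longrightarrow> norm (u (real n * h) - u 0 - h *\<^sub>R (\<Sum>j<n. g (real j * h + s (Suc j) * h))) \<le> q) \<Longrightarrow>
      n \<le> N \<Longrightarrow> norm (u (real n * h) - S h s n) \<le> (q + K * h powr b) * E"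
    and "0 \<le> K" and "0 \<le> E" and "r \<le> 1/2 + \<gamma>" and "r \<le> b" and "0 < \<epsilon>"
  shows "\<exists>k \<in> measurable M (count_space (UNIV :: nat set)). \<exists>A \<in> sets M. measure M A = 1 \<and>
    (\<forall>\<omega>\<in>A. \<forall>m\<ge>1. m \<ge> k \<omega> \<longrightarrow>
      (MAX n\<in>{0..nsteps T (h m)}. norm (u (real n * h m) - S (h m) (\<lambda>j. \<tau> j \<omega>) n)) \<le> h m powr (r - \<epsilon>))"
proof -
  \<comment> \<open>The quadrature lemmas need continuity on the whole line.\<close>
  define g' where "g' t = g (max 0 (min T t))" for t
  have g'_eq: "g' t = g t" if "t \<in> {0..T}" for t
    using that by (simp add: g'_def min_absorb2 max_absorb2)
  have g'_cont: "continuous_on UNIV g'"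
    unfolding g'_def using \<open>0 < T\<close> by (intro continuous_on_compose2[OF g] continuous_intros) auto
  have [measurable]: "g' \<in> borel_measurable borel"
    using g'_cont by (rule borel_measurable_continuous_onI)
  define D where "D m n \<omega> = u (real n * h m) - u 0 - h m *\<^sub>R (\<Sum>j<n. g' (real j * h m + \<tau> (Suc j) \<omega> * h m))"
    for m n \<omega>
  have [measurable]: "D m n \<in> borel_measurable M" for m n
    unfolding D_def by measurable
  \<comment> \<open>The deterministic absorption of constants is bundled with the two random
    conditions, so that a single random index secures all three.\<close>
  define P where "P m \<omega> \<longleftrightarrow> (\<forall>n\<in>{..nsteps T (h m)}. norm (D m n \<omega>) \<le> h m powr (1/2 + \<gamma> - \<epsilon> / 2)) \<and>
    (\<forall>j. \<tau> (Suc j) \<omega> \<in> {0<..<1}) \<and> (h m powr (1/2 + \<gamma> - \<epsilon> / 2) + K * h m powr b) * E \<le> h m powr (r - \<epsilon>)"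
    for m \<omega>
  have small: "\<forall>\<^sub>F m in sequentially. (h m powr (1/2 + \<gamma> - \<epsilon> / 2) + K * h m powr b) * E \<le> h m powr (r - \<epsilon>)"
    using h sum_h assms by (intro eventually_error_le_powr step_sizes_at_right_0) auto
  have "AE \<omega> in M. \<forall>\<^sub>F m in sequentially. \<forall>n\<le>nsteps T (h m). norm (D m n \<omega>) \<le> h m powr (1/2 + \<gamma> - \<epsilon> / 2)"
    unfolding D_def using g'_cont
    by (rule quadrature_AE_eventually[where C = C and T = T]) (use assms in \<open>auto simp: g'_eq\<close>)
  moreover note AE_all_\<tau>_in_unit_interval
  ultimately have "AE \<omega> in M. \<forall>\<^sub>F m in sequentially. P m \<omega>"
  proof eventually_elim
    case (elim \<omega>)
    from elim(1) small show ?case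
      by eventually_elim (use elim(2) in \<open>auto simp: P_def\<close>)
  qed
  moreover have [measurable]: "Measurable.pred M (P m)" for m
    unfolding P_def greaterThanLessThan_iff by measurable
  ultimately obtain k A where k: "k \<in> measurable M (count_space (UNIV :: nat set))"
      and A: "A \<in> sets M" "prob A = 1" and P: "\<And>\<omega> m. \<omega> \<in> A \<Longrightarrow> k \<omega> \<le> m \<Longrightarrow> P m \<omega>"
    using eventually_random_index[of P] by blast
  have bound: "norm (u (real n * h m) - S (h m) (\<lambda>j. \<tau> j \<omega>) n) \<le> h m powr (r - \<epsilon>)"
    if "\<omega> \<in> A" "k \<omega> \<le> m" "1 \<le> m" "n \<le> nsteps T (h m)" for \<omega> m n
  proof -
    have Pm: "P m \<omega>"
      using P that by blast
    have hm: "0 < h m"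
      using h[OF that(3)] by simp
    have N: "real (nsteps T (h m)) * h m \<le> T"
      using nsteps_bounds[OF hm, of T] \<open>0 < T\<close> by simp
    have \<tau>: "\<tau> (Suc j) \<omega> \<in> {0..1}" for j
      using Pm by (auto simp: P_def less_imp_le)
    have "norm (u (real n * h m) - S (h m) (\<lambda>j. \<tau> j \<omega>) n) \<le> (h m powr (1/2 + \<gamma> - \<epsilon> / 2) + K * h m powr b) * E"
    proof (rule error[OF h[OF that(3)] N _ _ that(4)])
      fix n assume n: "n \<le> nsteps T (h m)"
      \<comment> \<open>All evaluation times lie in \<open>{0..T}\<close>, where the extension
        agrees with \<open>g\<close>.\<close>
      have "g' (real j * h m + \<tau> (Suc j) \<omega> * h m) = g (real j * h m + \<tau> (Suc j) \<omega> * h m)" if "j < n" for j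
        using that n by (intro g'_eq grid_points_in_interval(2)[OF hm N] \<tau>) auto
      then have "D m n \<omega> = u (real n * h m) - u 0 - h m *\<^sub>R (\<Sum>j<n. g (real j * h m + \<tau> (Suc j) \<omega> * h m))"
        by (simp add: D_def)
      then show "norm (u (real n * h m) - u 0 - h m *\<^sub>R (\<Sum>j<n. g (real j * h m + \<tau> (Suc j) \<omega> * h m)))
          \<le> h m powr (1/2 + \<gamma> - \<epsilon> / 2)"
        using Pm n unfolding P_def by (metis atMost_iff)
    qed (rule \<tau>)
    also have "\<dots> \<le> h m powr (r - \<epsilon>)"
      using Pm by (simp add: P_def)
    finally show ?thesis .
  qed
  show ?thesis
    using k A bound by (intro bexI[of _ k] bexI[of _ A]) auto
qed

end

section \<open>Rates of the randomized Euler and Runge-Kutta schemes\<close>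

theorem theorem5p4:
  fixes M :: "'w measure"
    and \<tau> :: "nat \<Rightarrow> 'w \<Rightarrow> real"
    and T \<gamma> L K :: real
    and u\<^sub>0 :: "real ^ 'd"
    and f :: "real \<Rightarrow> real ^ 'd \<Rightarrow> real ^ 'd"
    and u :: "real \<Rightarrow> real ^ 'd"
    and h :: "nat \<Rightarrow> real"
  assumes "prob_space M"
    and "prob_space.indep_vars M (\<lambda>_. borel) \<tau> {1..}"
    and "\<And>j. j \<ge> 1 \<Longrightarrow> distr M borel (\<tau> j) = uniform_measure lborel {0<..<1}"
    and "T > 0" and "0 < \<gamma>" and "\<gamma> \<le> 1"
    and "continuous_on ({0..T} \<times> UNIV) (\<lambda>(t, x). f t x)"
    and "L > 0" and "K > 0"
    and "\<And>t x\<^sub>1 x\<^sub>2. t \<in> {0..T} \<Longrightarrow> norm (f t x\<^sub>1 - f t x\<^sub>2) \<le> L * norm (x\<^sub>1 - x\<^sub>2)"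
    and "\<And>t\<^sub>1 t\<^sub>2 x. t\<^sub>1 \<in> {0..T} \<Longrightarrow> t\<^sub>2 \<in> {0..T} \<Longrightarrow>
           norm (f t\<^sub>1 x - f t\<^sub>2 x) \<le> K * (1 + norm x) * \<bar>t\<^sub>1 - t\<^sub>2\<bar> powr \<gamma>"
    and "\<And>t. t \<in> {0..T} \<Longrightarrow> (u has_vector_derivative f t (u t)) (at t within {0..T})"
    and "u 0 = u\<^sub>0"
    and "\<And>m. m \<ge> 1 \<Longrightarrow> h m \<in> {0<..<1}"
    and "summable (\<lambda>m. h (Suc m))"
  shows "(\<forall>\<epsilon>\<in>{0<..<1/2}. \<exists>m\<^sub>U \<in> measurable M (count_space (UNIV :: nat set)).
            \<exists>A\<^sub>U \<in> sets M. measure M A\<^sub>U = 1 \<and>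
              (\<forall>\<omega>\<in>A\<^sub>U. \<forall>m\<ge>1. m \<ge> m\<^sub>U \<omega> \<longrightarrow>
                (MAX n\<in>{0..nsteps T (h m)}.
                   norm (u (real n * h m) - randomized_euler f u\<^sub>0 (h m) (\<lambda>j. \<tau> j \<omega>) n))
                \<le> h m powr (min 1 (1/2 + \<gamma>) - \<epsilon>))) \<and>
         (\<forall>\<epsilon>\<in>{0<..<1/2}. \<exists>m\<^sub>V \<in> measurable M (count_space (UNIV :: nat set)).
            \<exists>A\<^sub>V \<in> sets M. measure M A\<^sub>V = 1 \<and>
              (\<forall>\<omega>\<in>A\<^sub>V. \<forall>m\<ge>1. m \<ge> m\<^sub>V \<omega> \<longrightarrow>
                (MAX n\<in>{0..nsteps T (h m)}.
                   norm (u (real n * h m) - randomized_runge_kutta f u\<^sub>0 (h m) (\<lambda>j. \<tau> j \<omega>) n))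
                \<le> h m powr (1/2 + \<gamma> - \<epsilon>)))"
proof -
  interpret iid_uniform M \<tau>
    using assms(1-3) by (simp add: iid_uniform_def iid_uniform_axioms_def)
  obtain B C where "0 < B" "0 < C"
    and g: "continuous_on {0..T} (\<lambda>t. f t (u t))"
    and u_lipschitz: "\<And>s t. s \<in> {0..T} \<Longrightarrow> t \<in> {0..T} \<Longrightarrow> norm (u s - u t) \<le> B * \<bar>s - t\<bar>"
    and g_holder: "\<And>s t. s \<in> {0..T} \<Longrightarrow> t \<in> {0..T} \<Longrightarrow> norm (f s (u s) - f t (u t)) \<le> C * \<bar>s - t\<bar> powr \<gamma>"
    and u_taylor: "\<And>s t. s \<in> {0..T} \<Longrightarrow> t \<in> {0..T} \<Longrightarrow>
      norm (u s - u t - (s - t) *\<^sub>R f t (u t)) \<le> C * \<bar>s - t\<bar> powr (1 + \<gamma>)"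
    using solution_regularity[OF assms(4-6,8,9,7,10-12)] by blast
  note rate = pathwise_convergence_rate[where h = h, OF g assms(12) g_holder \<open>0 < C\<close> assms(5,4,14,15)]
  show ?thesis
  proof (intro conjI ballI)
    fix \<epsilon> :: real assume \<epsilon>: "\<epsilon> \<in> {0<..<1/2}"
    show "\<exists>m\<^sub>U \<in> measurable M (count_space (UNIV :: nat set)). \<exists>A\<^sub>U \<in> sets M. measure M A\<^sub>U = 1 \<and>
      (\<forall>\<omega>\<in>A\<^sub>U. \<forall>m\<ge>1. m \<ge> m\<^sub>U \<omega> \<longrightarrow>
        (MAX n\<in>{0..nsteps T (h m)}. norm (u (real n * h m) - randomized_euler f u\<^sub>0 (h m) (\<lambda>j. \<tau> j \<omega>) n))
          \<le> h m powr (min 1 (1/2 + \<gamma>) - \<epsilon>))"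
    \<comment> \<open>The consistency order 1 competes with the quadrature order
      \<open>1/2 + \<gamma>\<close>, which is where the minimum comes from.\<close>
    proof (rule rate[where b = 1 and K = "T * L * B" and E = "exp (L * T)"])
      fix h' s N q n
      assume "h' \<in> {0<..<1::real}" "real N * h' \<le> T" "\<And>j. s (Suc j) \<in> {0..1::real}"
        and "\<And>n. n \<le> N \<Longrightarrow> norm (u (real n * h') - u 0
          - h' *\<^sub>R (\<Sum>j<n. f (real j * h' + s (Suc j) * h') (u (real j * h' + s (Suc j) * h')))) \<le> q" "n \<le> N"
      then show "norm (u (real n * h') - randomized_euler f u\<^sub>0 h' s n) \<le> (q + T * L * B * h' powr 1) * exp (L * T)"
        using randomized_euler_error[OF assms(10) u_lipschitz,
            where h = h' and N = N and s = s and q = q and n = n] assms(8,13) \<open>0 < B\<close>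
        by simp
    qed (use assms(4,8) \<open>0 < B\<close> \<epsilon> in auto)
    show "\<exists>m\<^sub>V \<in> measurable M (count_space (UNIV :: nat set)). \<exists>A\<^sub>V \<in> sets M. measure M A\<^sub>V = 1 \<and>
      (\<forall>\<omega>\<in>A\<^sub>V. \<forall>m\<ge>1. m \<ge> m\<^sub>V \<omega> \<longrightarrow>
        (MAX n\<in>{0..nsteps T (h m)}. norm (u (real n * h m) - randomized_runge_kutta f u\<^sub>0 (h m) (\<lambda>j. \<tau> j \<omega>) n))
          \<le> h m powr (1/2 + \<gamma> - \<epsilon>))"
    \<comment> \<open>Here the consistency order exceeds \<open>1/2 + \<gamma>\<close>, so the
      quadrature alone fixes the rate.\<close>
    proof (rule rate[where b = "1 + \<gamma>" and K = "T * L * C" and E = "exp (L * (1 + L) * T)"])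
      fix h' s N q n
      assume "h' \<in> {0<..<1::real}" "real N * h' \<le> T" "\<And>j. s (Suc j) \<in> {0..1::real}"
        and "\<And>n. n \<le> N \<Longrightarrow> norm (u (real n * h') - u 0
          - h' *\<^sub>R (\<Sum>j<n. f (real j * h' + s (Suc j) * h') (u (real j * h' + s (Suc j) * h')))) \<le> q" "n \<le> N"
      then show "norm (u (real n * h') - randomized_runge_kutta f u\<^sub>0 h' s n)
          \<le> (q + T * L * C * h' powr (1 + \<gamma>)) * exp (L * (1 + L) * T)"
        using randomized_runge_kutta_error[OF assms(10) u_taylor,
            where h = h' and N = N and s = s and q = q and n = n] assms(5,8,13) \<open>0 < C\<close>
        by simp
    qed (use assms(4,5,8) \<open>0 < C\<close> \<epsilon> in auto)
  qed
qed

end
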